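(* Let $q=x_0^2+x_1^2+x_2^2+x_3^2$ and $f_0=x_0^4+x_1^4+x_2^4+x_3^4$. The space $\mathbb{C}[x_0,x_1,x_2,x_3]^{(OO)'}_4$ of $(OO)'$-invariant homogeneous polynomials of degree $4$ is two-dimensional and is generated by $q^2$ and $f_0$.
   Context: Identify $\mathbb{R}^4$ with the quaternions via $(x_0,x_1,x_2,x_3)\leftrightarrow x_0+x_1 i+x_2 j+x_3 k$. A pair $(g_1,g_2)$ of unit quaternions acts on $\mathbb{R}^4$ by $p\mapsto g_1\,p\,g_2^{-1}$; this gives the double covering $SU(2)\times SU(2)\to SO(4)$. Put $\tilde V=\langle i,j\rangle$ (quaternion group of order 8) and $\tilde O=\langle i,\ \frac{1+i}{\sqrt2},\ \frac12(1+i-j+k)\rangle$ (binary octahedral group, order 48); $\tilde V$ is normal in $\tilde O$. The group $(OO)'\subset SO(4)$ (order 192) is the image of $\{(p,q)\in\tilde O\times\tilde O: p\tilde V=q\tilde V\}$. $SO(4)$ acts on $\mathbb{C}[x_0,x_1,x_2,x_3]$ by linear substitution. *)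

theory Defs
  imports "HOL-Analysis.Cartesian_Space" "HOL-Library.Poly_Mapping" "HOL-Algebra.Generated_Groups"
begin

section \<open>Quaternions\<close>

datatype quat = Quat (qRe: real) (qI: real) (qJ: real) (qK: real)

instantiation quat :: ring_1
begin

definition "0 = Quat 0 0 0 0"
definition "1 = Quat 1 0 0 0"
definition "- x = Quat (- qRe x) (- qI x) (- qJ x) (- qK x)"
definition "x + y = Quat (qRe x + qRe y) (qI x + qI y) (qJ x + qJ y) (qK x + qK y)"
definition "x - y = Quat (qRe x - qRe y) (qI x - qI y) (qJ x - qJ y) (qK x - qK y)"
definition "x * y = Quat
  (qRe x * qRe y - qI x * qI y - qJ x * qJ y - qK x * qK y)
  (qRe x * qI y + qI x * qRe y + qJ x * qK y - qK x * qJ y)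
  (qRe x * qJ y - qI x * qK y + qJ x * qRe y + qK x * qI y)
  (qRe x * qK y + qI x * qJ y - qJ x * qI y + qK x * qRe y)"

instance
  by standard
    (simp_all add: zero_quat_def one_quat_def uminus_quat_def plus_quat_def minus_quat_def
      times_quat_def algebra_simps)

end

definition qnormsq :: "quat \<Rightarrow> real" where
  "qnormsq x = (qRe x)\<^sup>2 + (qI x)\<^sup>2 + (qJ x)\<^sup>2 + (qK x)\<^sup>2"

lemma qnormsq_eq_0_iff: "qnormsq x = 0 \<longleftrightarrow> x = 0"
  by (cases x) (simp add: qnormsq_def zero_quat_def add_nonneg_eq_0_iff)

lemma qnormsq_mult: "qnormsq (x * y) = qnormsq x * qnormsq y"
  by (simp add: qnormsq_def times_quat_def power2_eq_square algebra_simps)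

instantiation quat :: real_div_algebra
begin

definition "r *\<^sub>R x = Quat (r * qRe x) (r * qI x) (r * qJ x) (r * qK x)"
definition "inverse x =
  (1 / qnormsq x) *\<^sub>R Quat (qRe x) (- qI x) (- qJ x) (- qK x)"
definition "x div y = x * inverse y" for x y :: quat

instance
proof
  fix x :: quat
  assume "x \<noteq> 0"
  then have *: "(qRe x)\<^sup>2 + (qI x)\<^sup>2 + (qJ x)\<^sup>2 + (qK x)\<^sup>2 \<noteq> 0"
    using qnormsq_eq_0_iff[of x] by (simp add: qnormsq_def)
  show "inverse x * x = 1" "x * inverse x = 1"
    using * by (simp_all add: inverse_quat_def scaleR_quat_def times_quat_def one_quat_def
        qnormsq_def divide_simps; simp add: power2_eq_square algebra_simps)+
qed (simp_all add: inverse_quat_def divide_quat_def scaleR_quat_def times_quat_def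
      plus_quat_def zero_quat_def one_quat_def algebra_simps)

end

definition qi :: quat where "qi = Quat 0 1 0 0"
definition qj :: quat where "qj = Quat 0 0 1 0"
definition qk :: quat where "qk = Quat 0 0 0 1"

text \<open>The multiplicative group of unit quaternions, i.e. \<open>SU(2)\<close>.\<close>

definition unit_quats :: "quat monoid" where
  "unit_quats = \<lparr>carrier = {x. qnormsq x = 1}, mult = (*), one = 1\<rparr>"

lemma group_unit_quats: "group unit_quats"
proof (rule groupI)
  fix x assume x: "x \<in> carrier unit_quats"
  have 1: "qnormsq 1 = 1" by (simp add: qnormsq_def one_quat_def)
  from x have "x \<noteq> 0" using qnormsq_eq_0_iff[of x] by (auto simp: unit_quats_def)
  then have inv: "inverse x * x = 1" by simp
  moreover have "qnormsq (inverse x) = 1"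
    using qnormsq_mult[of "inverse x" x] x inv 1 by (simp add: unit_quats_def)
  ultimately show "\<exists>y\<in>carrier unit_quats. y \<otimes>\<^bsub>unit_quats\<^esub> x = \<one>\<^bsub>unit_quats\<^esub>"
    by (auto simp: unit_quats_def)
qed (auto simp: unit_quats_def qnormsq_mult mult.assoc, simp add: qnormsq_def one_quat_def)

definition V_tilde :: "quat set" where
  "V_tilde = generate unit_quats {qi, qj}"

definition O_tilde :: "quat set" where
  "O_tilde = generate unit_quats {qi, (1 + qi) /\<^sub>R sqrt 2, (1 / 2) *\<^sub>R (1 + qi - qj + qk)}"


section \<open>The group \<open>(OO)'\<close> as a set of real \<open>4 \<times> 4\<close> matrices\<close>

text \<open>
  The index type \<open>4\<close> has the elements \<open>0, 1, 2, 3\<close> (with \<open>4 = 0\<close>), which are used as the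
  indices of the coordinates \<open>x\<^sub>0, x\<^sub>1, x\<^sub>2, x\<^sub>3\<close>.
\<close>

definition quat_of_vec :: "real ^ 4 \<Rightarrow> quat" where
  "quat_of_vec x = Quat (x $ 0) (x $ 1) (x $ 2) (x $ 3)"

definition vec_of_quat :: "quat \<Rightarrow> real ^ 4" where
  "vec_of_quat p =
    (\<chi> n. if n = 0 then qRe p else if n = 1 then qI p else if n = 2 then qJ p else qK p)"

lemma quat_of_vec_of_quat: "quat_of_vec (vec_of_quat p) = p"
  by (simp add: quat_of_vec_def vec_of_quat_def)

lemma vec_of_quat_of_vec: "vec_of_quat (quat_of_vec x) = x"
proof -
  have "n = 0 \<or> n = 1 \<or> n = 2 \<or> n = 3" for n :: 4
    using exhaust_4[of n] by auto
  then show ?thesis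
    unfolding quat_of_vec_def vec_of_quat_def vec_eq_iff by force
qed

definition rotation :: "quat \<Rightarrow> quat \<Rightarrow> real ^ 4 \<Rightarrow> real ^ 4" where
  "rotation g1 g2 x = vec_of_quat (g1 * quat_of_vec x * inverse g2)"

lemma linear_rotation: "linear (rotation p q)"
  by (rule linearI)
    (simp_all add: rotation_def vec_eq_iff vec_of_quat_def quat_of_vec_def times_quat_def
      scaleR_quat_def algebra_simps)

lemma norm_rotation:
  assumes "p \<in> carrier unit_quats" "q \<in> carrier unit_quats"
  shows "qnormsq (quat_of_vec (rotation p q x)) = qnormsq (quat_of_vec x)"
proof -
  have "q \<noteq> 0" using assms(2) qnormsq_eq_0_iff[of q] by (auto simp: unit_quats_def)
  then have "qnormsq (inverse q) * qnormsq q = qnormsq 1" by (simp flip: qnormsq_mult)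
  then have "qnormsq (inverse q) = 1"
    using assms(2) by (simp add: unit_quats_def) (simp add: qnormsq_def one_quat_def)
  then show ?thesis
    using assms(1) by (simp add: rotation_def quat_of_vec_of_quat qnormsq_mult unit_quats_def)
qed

lemma generators_carrier:
  "{qi, qj} \<subseteq> carrier unit_quats"
  "{qi, (1 + qi) /\<^sub>R sqrt 2, (1 / 2) *\<^sub>R (1 + qi - qj + qk)} \<subseteq> carrier unit_quats"
  by (simp_all add: unit_quats_def qnormsq_def qi_def qj_def qk_def one_quat_def plus_quat_def
      minus_quat_def scaleR_quat_def power_divide power_inverse power_mult_distrib)

definition OO' :: "(real ^ 4 ^ 4) set" where
  "OO' = {matrix (rotation p q) | p q. p \<in> O_tilde \<and> q \<in> O_tilde \<and>
     p <#\<^bsub>unit_quats\<^esub> V_tilde = q <#\<^bsub>unit_quats\<^esub> V_tilde}"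


section \<open>The polynomial ring \<open>\<complex>[x\<^sub>0, x\<^sub>1, x\<^sub>2, x\<^sub>3]\<close>\<close>

text \<open>
  The monoid algebra over \<open>\<complex>\<close> of the monoid of exponent vectors; the multiplication of
  \<open>poly_mapping\<close> is convolution.
\<close>

type_synonym poly4 = "(4 \<Rightarrow>\<^sub>0 nat) \<Rightarrow>\<^sub>0 complex"

definition Const :: "complex \<Rightarrow> poly4" where
  "Const c = Poly_Mapping.single 0 c"

definition X :: "4 \<Rightarrow> poly4" where
  "X n = Poly_Mapping.single (Poly_Mapping.single n 1) 1"

global_interpretation poly4: vector_space "\<lambda>c f. Const c * f"
  by standard
    (simp_all add: Const_def algebra_simps single_add mult_single flip: mult.assoc)

definition homogeneous :: "nat \<Rightarrow> poly4 \<Rightarrow> bool" where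
  "homogeneous d f \<longleftrightarrow>
    (\<forall>m \<in> Poly_Mapping.keys f. (\<Sum>n\<in>UNIV. Poly_Mapping.lookup m n) = d)"

definition substitute :: "(4 \<Rightarrow> poly4) \<Rightarrow> poly4 \<Rightarrow> poly4" where
  "substitute s f = (\<Sum>m\<in>Poly_Mapping.keys f.
     Const (Poly_Mapping.lookup f m) * (\<Prod>n\<in>UNIV. s n ^ Poly_Mapping.lookup m n))"

text \<open>
  \<open>linear_subst A f\<close> is \<open>f(A x)\<close>. The left action of a matrix group uses \<open>A\<inverse>\<close> in place of
  \<open>A\<close>; both have the same invariants.
\<close>

definition linear_subst :: "real ^ 4 ^ 4 \<Rightarrow> poly4 \<Rightarrow> poly4" where
  "linear_subst A = substitute (\<lambda>n. \<Sum>l\<in>UNIV. Const (complex_of_real (A $ n $ l)) * X l)"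

definition invariant_forms :: "(real ^ 4 ^ 4) set \<Rightarrow> nat \<Rightarrow> poly4 set" where
  "invariant_forms G d = {f. homogeneous d f \<and> (\<forall>A\<in>G. linear_subst A f = f)}"

end

(* (OO)' acts on R^4 by signed permutations of the coordinates: the pairs (p, p) act by the rotations
   of the cube on x_1, x_2, x_3, and left multiplication by the quaternion group permutes the
   coordinates up to sign.  Hence q and f_0 are invariant.  Conversely, a signed permutation permutes
   the coefficients of a form up to sign.  With i on the left and conjugation by u = (1 + i)/sqrt 2
   and w = (1 + i - j + k)/2, this kills every quartic monomial with an odd exponent, and the
   remaining ones form the two orbits of x_0^4 and x_0^2 x_1^2.  So an invariant quartic is
   determined by two coefficients, and these separate q^2 and f_0. *)
theory Submission
  imports Defs
begin

text \<open>The library enumerates this type as 1, 2, 3, 4. Since \<open>4 = 0\<close> in it, the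
  same elements can be listed from 0, in line with the coordinates x_0, ..., x_3.\<close>

lemma exhaust_4_from_0: "n = 0 \<or> n = 1 \<or> n = 2 \<or> n = 3" for n :: 4
  using exhaust_4[of n] by auto

lemma all_4_from_0: "(\<forall>n::4. P n) \<longleftrightarrow> P 0 \<and> P 1 \<and> P 2 \<and> P 3"
  by (metis exhaust_4_from_0)

lemma sum_4_from_0: "(\<Sum>n\<in>(UNIV::4 set). f n) = f 0 + f 1 + f 2 + f 3"
proof -
  have "(4::4) = 0" by simp
  then show ?thesis by (simp only: sum_4 ac_simps)
qed

lemma prod_4_from_0: "(\<Prod>n\<in>(UNIV::4 set). f n) = f 0 * f 1 * f 2 * f 3"
proof -
  have "(4::4) = 0" by simp
  moreover have "f 1 * (f 2 * (f 3 * f 4)) = prod f UNIV"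
    unfolding UNIV_4 by simp
  ultimately show ?thesis by (simp only: ac_simps)
qed


section \<open>Polynomials\<close>

text \<open>Updating at a key outside the support is the same as adding a monomial, so additive
  properties need checking only on monomials.\<close>

lemma poly_mapping_single_add_induct [case_names zero add]:
  fixes f :: "'a \<Rightarrow>\<^sub>0 'b::comm_monoid_add"
  assumes "P 0" and "\<And>k c f. P f \<Longrightarrow> P (Poly_Mapping.single k c + f)"
  shows "P f"
proof (induction f rule: update_induct)
  case const
  then show ?case by (rule assms(1))
next
  case (update f k c)
  have "Poly_Mapping.update k c f = Poly_Mapping.single k c + f"
    using update(1)
    by (intro poly_mapping_eqI)
      (auto simp: lookup_add lookup_single lookup_update when_def in_keys_iff)
  then show ?case using assms(2) update(3) by simp
qed

text \<open>Extra exponents carry coefficient 0 and contribute nothing. This lets polynomials with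
  different supports be summed over one common index set.\<close>

lemma substitute_superset:
  assumes "finite S" "Poly_Mapping.keys f \<subseteq> S"
  shows "substitute s f = (\<Sum>m\<in>S.
     Const (Poly_Mapping.lookup f m) * (\<Prod>n\<in>UNIV. s n ^ Poly_Mapping.lookup m n))"
  unfolding substitute_def using assms
  by (intro sum.mono_neutral_left) (auto simp: in_keys_iff Const_def)

lemma substitute_zero [simp]: "substitute s 0 = 0"
  by (simp add: substitute_def)

lemma substitute_add: "substitute s (f + g) = substitute s f + substitute s g"
proof -
  let ?S = "Poly_Mapping.keys f \<union> Poly_Mapping.keys g"
  have "Poly_Mapping.keys (f + g) \<subseteq> ?S" by (rule Poly_Mapping.keys_add)
  then show ?thesis
    by (simp add: substitute_superset[where S = ?S] lookup_add Const_def single_add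
        distrib_right sum.distrib)
qed

lemma substitute_single:
  "substitute s (Poly_Mapping.single m c) = Const c * (\<Prod>n\<in>UNIV. s n ^ Poly_Mapping.lookup m n)"
  by (subst substitute_superset[where S = "{m}"]) auto

text \<open>Both sides are additive in each factor, so two inductions, first on \<open>g\<close> and
  then on \<open>f\<close>, reduce the claim to a product of monomials, where exponents add.\<close>

lemma substitute_mult: "substitute s (f * g) = substitute s f * substitute s g"
proof -
  have single_single: "substitute s (Poly_Mapping.single k c * Poly_Mapping.single m d) =
      substitute s (Poly_Mapping.single k c) * substitute s (Poly_Mapping.single m d)" for k c m d
  proof -
    have "Const (c * d) = Const c * Const d"
      by (simp add: Const_def mult_single)
    then show ?thesis
      by (simp only: mult_single substitute_single lookup_add power_add prod.distrib mult_ac)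
  qed
  have "substitute s (Poly_Mapping.single k c * g) =
      substitute s (Poly_Mapping.single k c) * substitute s g" for k c
    by (induction g rule: poly_mapping_single_add_induct)
      (simp_all add: distrib_left substitute_add single_single)
  then show ?thesis
    by (induction f rule: poly_mapping_single_add_induct)
      (simp_all add: distrib_right substitute_add)
qed

lemma Const_1: "Const 1 = 1"
  by (simp add: Const_def)

lemma substitute_Const: "substitute s (Const c) = Const c"
  by (simp add: Const_def substitute_single)

lemma substitute_power: "substitute s (f ^ k) = substitute s f ^ k"
  by (induction k) (use substitute_Const[of s 1] in \<open>simp_all add: substitute_mult Const_1\<close>)

lemma substitute_X: "substitute s (X n) = s n"
proof -
  have "s l ^ Poly_Mapping.lookup (Poly_Mapping.single n 1) l = (if l = n then s l else 1)" for l
    by (simp add: lookup_single when_def)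
  then show ?thesis by (simp add: X_def substitute_single Const_1)
qed

lemma X_power: "X n ^ k = Poly_Mapping.single (Poly_Mapping.single n k) 1"
  by (induction k) (simp_all add: X_def mult_single flip: single_add)

lemma Const_power: "Const c ^ k = Const (c ^ k)"
  by (induction k) (simp_all add: Const_def mult_single)

lemma homogeneous_add: "homogeneous d f \<Longrightarrow> homogeneous d g \<Longrightarrow> homogeneous d (f + g)"
  unfolding homogeneous_def using Poly_Mapping.keys_add[of f g] by blast

lemma homogeneous_mult:
  assumes "homogeneous d f" "homogeneous e g"
  shows "homogeneous (d + e) (f * g)"
  unfolding homogeneous_def
proof
  fix m assume "m \<in> Poly_Mapping.keys (f * g)"
  then obtain a b where "m = a + b" "a \<in> Poly_Mapping.keys f" "b \<in> Poly_Mapping.keys g"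
    using Poly_Mapping.keys_mult[of f g] by blast
  then show "(\<Sum>n\<in>UNIV. Poly_Mapping.lookup m n) = d + e"
    using assms by (simp add: homogeneous_def lookup_add sum.distrib)
qed

lemma homogeneous_Const: "homogeneous 0 (Const c)"
  by (simp add: homogeneous_def Const_def)

lemma homogeneous_X_power: "homogeneous k (X n ^ k)"
  by (simp add: homogeneous_def X_power lookup_single when_def)

lemma subspace_invariant_forms: "poly4.subspace (invariant_forms G d)"
proof (rule poly4.subspaceI)
  show "0 \<in> invariant_forms G d"
    by (simp add: invariant_forms_def homogeneous_def linear_subst_def)
  show "f + g \<in> invariant_forms G d" if "f \<in> invariant_forms G d" "g \<in> invariant_forms G d" for f g
    using that by (simp add: invariant_forms_def homogeneous_add linear_subst_def substitute_add)
  show "Const c * f \<in> invariant_forms G d" if "f \<in> invariant_forms G d" for c f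
    using that homogeneous_mult[OF homogeneous_Const]
    by (fastforce simp: invariant_forms_def linear_subst_def substitute_mult substitute_Const)
qed


section \<open>Signed permutations\<close>

text \<open>\<open>\<pi> n\<close> is the coordinate from which the n-th output is read, not the
  place to which x_n moves. With this convention substitution sends \<open>X n\<close> to plus or
  minus \<open>X (\<pi> n)\<close>.\<close>

definition signed_permutation :: "(4 \<Rightarrow> 4) \<Rightarrow> (4 \<Rightarrow> real) \<Rightarrow> (real ^ 4 \<Rightarrow> real ^ 4) \<Rightarrow> bool" where
  "signed_permutation \<pi> s f \<longleftrightarrow>
    bij \<pi> \<and> (\<forall>n. s n = 1 \<or> s n = -1) \<and> (\<forall>x n. f x $ n = s n * x $ \<pi> n)"

lemma signed_permutation_id: "signed_permutation id (\<lambda>_. 1) (\<lambda>x. x)"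
  by (simp add: signed_permutation_def)

lemma signed_permutation_comp:
  assumes "signed_permutation \<pi> s f" "signed_permutation \<rho> t g"
  shows "signed_permutation (\<rho> \<circ> \<pi>) (\<lambda>n. s n * t (\<pi> n)) (\<lambda>x. f (g x))"
proof -
  have "s n * t (\<pi> n) = 1 \<or> s n * t (\<pi> n) = -1" for n
  proof -
    have "s n = 1 \<or> s n = -1" "t (\<pi> n) = 1 \<or> t (\<pi> n) = -1"
      using assms by (simp_all add: signed_permutation_def)
    then show ?thesis by auto
  qed
  \<comment> \<open>The order is reversed because \<open>\<pi>\<close> names sources: coordinate n
    of \<open>f (g x)\<close> is read from coordinate \<open>\<pi> n\<close> of \<open>g x\<close>,
    hence from \<open>\<rho> (\<pi> n)\<close> of \<open>x\<close>.\<close>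
  moreover have "bij (\<rho> \<circ> \<pi>)" using assms by (auto simp: signed_permutation_def intro: bij_comp)
  ultimately show ?thesis using assms by (simp add: signed_permutation_def mult.assoc)
qed

text \<open>Reading \<open>f (g x) = x\<close> at the index \<open>inv_into UNIV \<pi> n\<close>
  isolates \<open>g x $ n\<close> up to a sign, and a sign is its own inverse.\<close>

lemma signed_permutation_inverse:
  assumes f: "signed_permutation \<pi> s f" and g: "\<And>x. f (g x) = x"
  shows "signed_permutation (inv_into UNIV \<pi>) (\<lambda>n. s (inv_into UNIV \<pi> n)) g"
proof -
  have \<pi>: "bij \<pi>" using f by (simp add: signed_permutation_def)
  have "g x $ n = s (inv_into UNIV \<pi> n) * x $ inv_into UNIV \<pi> n" for x n
  proof -
    have "f (g x) $ inv_into UNIV \<pi> n = s (inv_into UNIV \<pi> n) * g x $ n"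
      using f \<pi> by (simp add: signed_permutation_def bij_is_surj surj_f_inv_f)
    then have "x $ inv_into UNIV \<pi> n = s (inv_into UNIV \<pi> n) * g x $ n"
      by (simp only: g)
    moreover have "s (inv_into UNIV \<pi> n) = 1 \<or> s (inv_into UNIV \<pi> n) = -1"
      using f by (simp add: signed_permutation_def)
    ultimately show ?thesis by auto
  qed
  then show ?thesis using f \<pi> by (auto simp: signed_permutation_def bij_imp_bij_inv)
qed

lemma linear_subst_signed_permutation:
  assumes "signed_permutation \<pi> s f"
  shows "linear_subst (matrix f) = substitute (\<lambda>n. Const (complex_of_real (s n)) * X (\<pi> n))"
proof -
  have "(\<Sum>l\<in>UNIV. Const (complex_of_real (matrix f $ n $ l)) * X l) =
      Const (complex_of_real (s n)) * X (\<pi> n)" for n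
  proof -
    have "Const (complex_of_real (matrix f $ n $ l)) * X l =
        (if l = \<pi> n then Const (complex_of_real (s n)) * X l else 0)" for l
      using assms by (simp add: matrix_def signed_permutation_def axis_def Const_def)
    then show ?thesis by simp
  qed
  then show ?thesis by (simp add: linear_subst_def)
qed

text \<open>Even powers absorb the signs, and the bijection only reorders the summands. The
  exponents 2 and 4 give the invariance of q and f_0.\<close>

lemma linear_subst_power_sum:
  assumes f: "signed_permutation \<pi> s f" and k: "even k"
  shows "linear_subst (matrix f) (X 0 ^ k + X 1 ^ k + X 2 ^ k + X 3 ^ k) =
    X 0 ^ k + X 1 ^ k + X 2 ^ k + X 3 ^ k"
proof -
  have "complex_of_real (s n) ^ k = 1" for n
  proof -
    have "s n = 1 \<or> s n = -1" using f by (simp add: signed_permutation_def)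
    then show ?thesis using k by auto
  qed
  then have "linear_subst (matrix f) (\<Sum>n\<in>UNIV. X n ^ k) = (\<Sum>n\<in>UNIV. X (\<pi> n) ^ k)"
    by (simp add: linear_subst_signed_permutation[OF f] sum_4_from_0 substitute_add
        substitute_power substitute_X power_mult_distrib Const_power Const_1)
  also have "\<dots> = (\<Sum>n\<in>UNIV. X n ^ k)"
    using f by (intro sum.reindex_bij_betw) (simp add: signed_permutation_def)
  finally show ?thesis by (simp add: sum_4_from_0)
qed

section \<open>Action of signed permutations on coefficients\<close>

lemma lookup_permuted_exponent:
  fixes m :: "4 \<Rightarrow>\<^sub>0 nat"
  assumes "bij \<pi>"
  shows "Poly_Mapping.lookup (\<Sum>n\<in>UNIV. Poly_Mapping.single (\<pi> n) (Poly_Mapping.lookup m n)) (\<pi> l) =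
    Poly_Mapping.lookup m l"
proof -
  have "(Poly_Mapping.lookup m n when \<pi> n = \<pi> l) = (if n = l then Poly_Mapping.lookup m n else 0)" for n
    using assms by (auto simp: when_def bij_def inj_eq)
  then show ?thesis by (simp add: lookup_sum lookup_single)
qed

text \<open>Each monomial goes to a signed monomial, and distinct monomials go to distinct ones.
  Hence a coefficient of the image comes from exactly one coefficient of \<open>p\<close>.\<close>

lemma lookup_linear_subst_signed_permutation:
  assumes f: "signed_permutation \<pi> s f"
  shows "Poly_Mapping.lookup (linear_subst (matrix f) p)
      (\<Sum>n\<in>UNIV. Poly_Mapping.single (\<pi> n) (Poly_Mapping.lookup m n)) =
    (\<Prod>n\<in>UNIV. complex_of_real (s n) ^ Poly_Mapping.lookup m n) * Poly_Mapping.lookup p m"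
proof -
  define P where "P k = (\<Sum>n\<in>UNIV. Poly_Mapping.single (\<pi> n) (Poly_Mapping.lookup k n))"
    for k :: "4 \<Rightarrow>\<^sub>0 nat"
  define S where "S k = (\<Prod>n\<in>UNIV. complex_of_real (s n) ^ Poly_Mapping.lookup k n)"
    for k :: "4 \<Rightarrow>\<^sub>0 nat"
  have P_inj: "P k = P m \<longleftrightarrow> k = m" for k
  proof
    assume eq: "P k = P m"
    show "k = m"
    proof (rule poly_mapping_eqI)
      fix l
      have "Poly_Mapping.lookup (P k) (\<pi> l) = Poly_Mapping.lookup (P m) (\<pi> l)"
        by (simp only: eq)
      then show "Poly_Mapping.lookup k l = Poly_Mapping.lookup m l"
        unfolding P_def using f
        by (simp only: lookup_permuted_exponent signed_permutation_def)
    qed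
  qed simp
  \<comment> \<open>The image of the monomial with exponent \<open>k\<close> has exponent
    \<open>P k\<close> and sign \<open>S k\<close>.\<close>
  have "(\<Prod>n\<in>UNIV. (Const (complex_of_real (s n)) * X (\<pi> n)) ^ Poly_Mapping.lookup k n) =
      Poly_Mapping.single (P k) (S k)" for k
    by (simp only: P_def S_def prod_4_from_0 sum_4_from_0 power_mult_distrib X_power Const_power)
      (simp add: Const_def mult_single ac_simps)
  then have "linear_subst (matrix f) p =
      (\<Sum>k\<in>Poly_Mapping.keys p. Poly_Mapping.single (P k) (Poly_Mapping.lookup p k * S k))"
    by (simp add: linear_subst_signed_permutation[OF f] substitute_def Const_def mult_single)
  then have "Poly_Mapping.lookup (linear_subst (matrix f) p) (P m) =
      (\<Sum>k\<in>Poly_Mapping.keys p. if k = m then Poly_Mapping.lookup p k * S k else 0)"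
    by (simp add: lookup_sum lookup_single when_def P_inj)
  also have "\<dots> = S m * Poly_Mapping.lookup p m"
    by (simp add: in_keys_iff)
  finally show ?thesis by (simp add: P_def S_def)
qed


section \<open>Elements of the group\<close>

lemma signed_permutation_rotationI:
  assumes "inj \<pi>" "\<forall>n. s n = 1 \<or> s n = -1" "\<And>x. \<forall>n. rotation p q x $ n = s n * x $ \<pi> n"
  shows "signed_permutation \<pi> s (rotation p q)"
  using assms finite_UNIV_inj_surj[of \<pi>] by (simp add: signed_permutation_def bij_def)

text \<open>Inversion reverses products, so right multiplication by inverses composes in the order
  of the pairs. The case of a zero factor is covered by \<open>inverse 0 = 0\<close>.\<close>

lemma rotation_mult: "rotation (g * h) (g' * h') x = rotation g g' (rotation h h' x)"
proof -
  have "inverse (g' * h') = inverse h' * inverse g'"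
    by (cases "g' = 0 \<or> h' = 0") (auto simp: nonzero_inverse_mult_distrib)
  then show ?thesis by (simp add: rotation_def quat_of_vec_of_quat mult.assoc)
qed

lemma rotation_1_1: "rotation 1 1 x = x"
  by (simp add: rotation_def vec_of_quat_of_vec)

lemma inverse_unit_quat:
  assumes "qnormsq p = 1"
  shows "inverse p = Quat (qRe p) (- qI p) (- qJ p) (- qK p)"
  using assms by (simp add: inverse_quat_def scaleR_quat_def)

text \<open>i (x_0 + x_1 i + x_2 j + x_3 k) = -x_1 + x_0 i - x_3 j + x_2 k.\<close>

lemma signed_permutation_left_i:
  "signed_permutation (\<lambda>n. if n = 0 then 1 else if n = 1 then 0 else if n = 2 then 3 else 2)
    (\<lambda>n. if n = 0 \<or> n = 2 then -1 else 1) (rotation qi 1)"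
  by (rule signed_permutation_rotationI)
    (simp_all add: inj_def all_4_from_0 rotation_def vec_of_quat_def quat_of_vec_def
      times_quat_def one_quat_def qi_def inverse_unit_quat qnormsq_def)

lemma signed_permutation_left_j:
  "signed_permutation (\<lambda>n. if n = 0 then 2 else if n = 1 then 3 else if n = 2 then 0 else 1)
    (\<lambda>n. if n = 0 \<or> n = 3 then -1 else 1) (rotation qj 1)"
  by (rule signed_permutation_rotationI)
    (simp_all add: inj_def all_4_from_0 rotation_def vec_of_quat_def quat_of_vec_def
      times_quat_def one_quat_def qj_def inverse_unit_quat qnormsq_def)

lemma signed_permutation_conj_i:
  "signed_permutation (\<lambda>n. n) (\<lambda>n. if n = 2 \<or> n = 3 then -1 else 1) (rotation qi qi)"
  by (rule signed_permutation_rotationI)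
    (simp_all add: inj_def all_4_from_0 rotation_def vec_of_quat_def quat_of_vec_def
      times_quat_def qi_def inverse_unit_quat qnormsq_def)

text \<open>Conjugation by u = (1 + i)/sqrt 2 is the quarter turn about the i-axis: j goes to k and
  k to -j.\<close>

lemma signed_permutation_conj_u:
  "signed_permutation (\<lambda>n. if n = 2 then 3 else if n = 3 then 2 else n)
    (\<lambda>n. if n = 2 then -1 else 1) (rotation ((1 + qi) /\<^sub>R sqrt 2) ((1 + qi) /\<^sub>R sqrt 2))"
proof -
  have u: "(1 + qi) /\<^sub>R sqrt 2 = Quat (1 / sqrt 2) (1 / sqrt 2) 0 0"
    by (simp add: one_quat_def qi_def plus_quat_def scaleR_quat_def inverse_eq_divide)
  show ?thesis
    unfolding u
    by (rule signed_permutation_rotationI)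
      (simp_all add: inj_def all_4_from_0 rotation_def vec_of_quat_def quat_of_vec_def
        times_quat_def inverse_unit_quat qnormsq_def power_divide, simp_all add: field_simps)
qed

text \<open>Conjugation by w = (1 + i - j + k)/2 is a third of a turn about the axis i - j + k: i
  goes to k, k to -j and j to -i.\<close>

lemma signed_permutation_conj_w:
  "signed_permutation (\<lambda>n. if n = 1 then 2 else if n = 2 then 3 else if n = 3 then 1 else n)
    (\<lambda>n. if n = 1 \<or> n = 2 then -1 else 1)
    (rotation ((1 / 2) *\<^sub>R (1 + qi - qj + qk)) ((1 / 2) *\<^sub>R (1 + qi - qj + qk)))"
proof -
  have w: "(1 / 2) *\<^sub>R (1 + qi - qj + qk) = Quat (1 / 2) (1 / 2) (- 1 / 2) (1 / 2)"
    by (simp add: one_quat_def qi_def qj_def qk_def plus_quat_def minus_quat_def scaleR_quat_def)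
  show ?thesis
    unfolding w
    by (rule signed_permutation_rotationI)
      (simp_all add: inj_def all_4_from_0 rotation_def vec_of_quat_def quat_of_vec_def
        times_quat_def inverse_unit_quat qnormsq_def power_divide, simp_all add: field_simps)
qed

text \<open>Signed permutations contain the identity and are closed under composition and inversion,
  so it is enough to test generators. The action \<open>\<phi>\<close> is left abstract to cover
  both conjugation and left multiplication.\<close>

lemma generate_signed_permutation:
  assumes g: "g \<in> generate unit_quats H" and H: "H \<subseteq> carrier unit_quats"
    and gen: "\<And>h. h \<in> H \<Longrightarrow> \<exists>\<pi> s. signed_permutation \<pi> s (\<phi> h)"
    and one: "\<And>x. \<phi> 1 x = x"
    and mult: "\<And>g h x. \<phi> (g * h) x = \<phi> g (\<phi> h x)"
  shows "\<exists>\<pi> s. signed_permutation \<pi> s (\<phi> g)"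
  using g
proof (induction g rule: generate.induct)
  case one
  have "\<phi> 1 = (\<lambda>x. x)" using assms(4) by auto
  then show ?case using signed_permutation_id by (auto simp: unit_quats_def)
next
  case (incl h)
  then show ?case by (rule gen)
next
  case (inv h)
  obtain \<pi> s where "signed_permutation \<pi> s (\<phi> h)" using gen[OF inv] by blast
  moreover have "h * inv\<^bsub>unit_quats\<^esub> h = 1"
    using group.r_inv[OF group_unit_quats, of h] inv H by (auto simp: unit_quats_def)
  then have "\<phi> h (\<phi> (inv\<^bsub>unit_quats\<^esub> h) x) = x" for x
    by (metis mult assms(4))
  ultimately show ?case using signed_permutation_inverse by blast
next
  case (eng g h)
  have "\<phi> (g * h) = (\<lambda>x. \<phi> g (\<phi> h x))" using mult by auto
  then show ?case using eng.IH signed_permutation_comp by (fastforce simp: unit_quats_def)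
qed

lemma OO'_signed_permutation:
  assumes "A \<in> OO'"
  obtains \<pi> s f where "A = matrix f" "signed_permutation \<pi> s f"
proof -
  \<comment> \<open>Writing \<open>p = q v\<close> with \<open>v \<in> V_tilde\<close> factors the rotation as \<open>x \<mapsto> q (v x) q\<inverse>\<close>.\<close>
  obtain p q where A: "A = matrix (rotation p q)" and p: "p \<in> O_tilde" and q: "q \<in> O_tilde"
    and pq: "p <#\<^bsub>unit_quats\<^esub> V_tilde = q <#\<^bsub>unit_quats\<^esub> V_tilde"
    using assms unfolding OO'_def by blast
  \<comment> \<open>As 1 lies in \<open>V_tilde\<close>, \<open>p\<close> lies in its own coset,
    which is also the coset of \<open>q\<close>; this produces \<open>v\<close>.\<close>
  have "1 \<in> V_tilde"
    unfolding V_tilde_def using generate.one[of unit_quats] by (simp add: unit_quats_def)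
  then have "p \<in> p <#\<^bsub>unit_quats\<^esub> V_tilde"
    by (force simp: l_coset_def unit_quats_def)
  then obtain v where v: "v \<in> V_tilde" and p_eq: "p = q * v"
    unfolding pq by (auto simp: l_coset_def unit_quats_def)
  have "\<exists>\<pi> s. signed_permutation \<pi> s (rotation q q)"
    using q[unfolded O_tilde_def] generators_carrier(2)
    by (rule generate_signed_permutation)
      (use signed_permutation_conj_i signed_permutation_conj_u signed_permutation_conj_w
        in \<open>auto simp: rotation_1_1 rotation_mult\<close>)
  moreover have "\<exists>\<pi> s. signed_permutation \<pi> s (rotation v 1)"
    using v[unfolded V_tilde_def] generators_carrier(1)
    by (rule generate_signed_permutation[where \<phi> = "\<lambda>v. rotation v 1"])
      (use signed_permutation_left_i signed_permutation_left_j rotation_mult[of _ _ 1 1]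
        in \<open>auto simp: rotation_1_1\<close>)
  moreover have "rotation p q = (\<lambda>x. rotation q q (rotation v 1 x))"
    using rotation_mult[of q v q 1] by (auto simp: p_eq)
  ultimately show ?thesis using that A signed_permutation_comp by metis
qed

section \<open>Explicit elements of (OO)'\<close>

lemma conj_in_OO': "p \<in> O_tilde \<Longrightarrow> matrix (rotation p p) \<in> OO'"
  unfolding OO'_def by blast

text \<open>The pair (i, 1) qualifies because i lies in \<open>V_tilde\<close>, so both cosets equal
  \<open>V_tilde\<close>. Unlike the diagonal pairs, it does not fix x_0.\<close>

lemma left_i_in_OO': "matrix (rotation qi 1) \<in> OO'"
proof -
  have V: "subgroup V_tilde unit_quats"
    unfolding V_tilde_def
    by (rule group.generate_is_subgroup[OF group_unit_quats generators_carrier(1)])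
  have i: "qi \<in> V_tilde"
    unfolding V_tilde_def by (simp add: generate.incl)
  have "qi <#\<^bsub>unit_quats\<^esub> V_tilde = V_tilde"
  proof -
    have "qi <#\<^bsub>unit_quats\<^esub> V_tilde \<subseteq> V_tilde"
      using subgroup.m_closed[OF V i] by (auto simp: l_coset_def)
    moreover have "v \<in> qi <#\<^bsub>unit_quats\<^esub> V_tilde" if v: "v \<in> V_tilde" for v
    proof -
      have "v = qi \<otimes>\<^bsub>unit_quats\<^esub> (inv\<^bsub>unit_quats\<^esub> qi \<otimes>\<^bsub>unit_quats\<^esub> v)"
        using group.inv_solve_left[OF group_unit_quats] subgroup.mem_carrier[OF V] i v
          subgroup.m_closed[OF V] subgroup.m_inv_closed[OF V] by metis
      then show ?thesis
        using subgroup.m_closed[OF V subgroup.m_inv_closed[OF V i] v]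
        by (auto simp: l_coset_def)
    qed
    ultimately show ?thesis by blast
  qed
  moreover have "1 <#\<^bsub>unit_quats\<^esub> V_tilde = V_tilde"
    by (auto simp: l_coset_def unit_quats_def)
  moreover have "qi \<in> O_tilde" "1 \<in> O_tilde"
    unfolding O_tilde_def using generate.one[of unit_quats]
    by (simp_all add: generate.incl) (simp add: unit_quats_def)
  ultimately show ?thesis unfolding OO'_def by blast
qed


section \<open>Invariants of degree four\<close>

definition exponent :: "nat \<Rightarrow> nat \<Rightarrow> nat \<Rightarrow> nat \<Rightarrow> 4 \<Rightarrow>\<^sub>0 nat" where
  "exponent a b c d = Poly_Mapping.single 0 a + Poly_Mapping.single 1 b +
    Poly_Mapping.single 2 c + Poly_Mapping.single 3 d"

lemma lookup_exponent:
  "Poly_Mapping.lookup (exponent a b c d) 0 = a" "Poly_Mapping.lookup (exponent a b c d) 1 = b"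
  "Poly_Mapping.lookup (exponent a b c d) 2 = c" "Poly_Mapping.lookup (exponent a b c d) 3 = d"
  by (simp_all add: exponent_def lookup_add lookup_single)

text \<open>Every exponent vector arises from four naturals, so the coefficients of a quartic can be
  studied through \<open>exponent\<close> alone.\<close>

lemma exponent_lookup:
  "exponent (Poly_Mapping.lookup m 0) (Poly_Mapping.lookup m 1)
    (Poly_Mapping.lookup m 2) (Poly_Mapping.lookup m 3) = m"
proof (rule poly_mapping_eqI)
  fix n :: 4
  show "Poly_Mapping.lookup (exponent (Poly_Mapping.lookup m 0) (Poly_Mapping.lookup m 1)
    (Poly_Mapping.lookup m 2) (Poly_Mapping.lookup m 3)) n = Poly_Mapping.lookup m n"
    using exhaust_4_from_0[of n] by (auto simp: lookup_exponent)
qed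

context
  fixes f :: poly4
  assumes f: "f \<in> invariant_forms OO' 4"
begin

lemma lookup_invariant:
  assumes "signed_permutation \<pi> s g" "matrix g \<in> OO'"
  shows "Poly_Mapping.lookup f (\<Sum>n\<in>UNIV. Poly_Mapping.single (\<pi> n) (Poly_Mapping.lookup m n)) =
    (\<Prod>n\<in>UNIV. complex_of_real (s n) ^ Poly_Mapping.lookup m n) * Poly_Mapping.lookup f m"
  using lookup_linear_subst_signed_permutation[OF assms(1), of f m] assms(2) f
  by (simp add: invariant_forms_def)

text \<open>Left multiplication by i swaps x_0 with x_1 and x_2 with x_3; the sign collects the
  exponents at the negated positions 0 and 2.\<close>

lemma lookup_left_i:
  "Poly_Mapping.lookup f (exponent b a d c) = (-1) ^ (a + c) * Poly_Mapping.lookup f (exponent a b c d)"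
  using lookup_invariant[OF signed_permutation_left_i left_i_in_OO', of "exponent a b c d"]
  unfolding sum_4_from_0 prod_4_from_0 lookup_exponent
  by (simp add: exponent_def power_add ac_simps)

lemma lookup_conj_u:
  "Poly_Mapping.lookup f (exponent a b d c) = (-1) ^ c * Poly_Mapping.lookup f (exponent a b c d)"
  using lookup_invariant[OF signed_permutation_conj_u conj_in_OO', of "exponent a b c d"]
  unfolding sum_4_from_0 prod_4_from_0 lookup_exponent O_tilde_def
  by (simp add: exponent_def generate.incl ac_simps)

lemma lookup_conj_w:
  "Poly_Mapping.lookup f (exponent a d b c) = (-1) ^ (b + c) * Poly_Mapping.lookup f (exponent a b c d)"
  using lookup_invariant[OF signed_permutation_conj_w conj_in_OO', of "exponent a b c d"]
  unfolding sum_4_from_0 prod_4_from_0 lookup_exponent O_tilde_def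
  by (simp add: exponent_def generate.incl power_add ac_simps)

text \<open>The three coefficient relations carry zeros along orbits of monomials and force the
  coefficients with an odd exponent to vanish. The two assumptions treat one representative of each
  remaining orbit.\<close>

lemma invariant_quartic_eq_0:
  assumes "Poly_Mapping.lookup f (exponent 4 0 0 0) = 0" "Poly_Mapping.lookup f (exponent 2 2 0 0) = 0"
  shows "f = 0"
proof (rule poly_mapping_eqI)
  fix m
  define Z where "Z a b c d \<longleftrightarrow> Poly_Mapping.lookup f (exponent a b c d) = 0" for a b c d
  have Z_i: "Z b a d c" if "Z a b c d" for a b c d
    using lookup_left_i[of b a d c] that by (simp add: Z_def)
  have Z_w: "Z a d b c" if "Z a b c d" for a b c d
    using lookup_conj_w[of a d b c] that by (simp add: Z_def)
  \<comment> \<open>Applying the u-relation twice returns to the same monomial with sign (-1)^(c+d),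
    so for odd c + d the coefficient is its own negative.\<close>
  have Z_parity: "Z a b c d" if "odd (c + d)" for a b c d
    using lookup_conj_u[of a b c d] lookup_conj_u[of a b d c] that
    by (auto simp: Z_def uminus_power_if split: if_splits)
  \<comment> \<open>Here u fixes the monomial and reverses its sign.\<close>
  have Z_1111: "Z 1 1 1 1"
    using lookup_conj_u[of 1 1 1 1] by (simp add: Z_def)
  have Z_4: "Z 4 0 0 0" "Z 0 4 0 0" "Z 0 0 4 0" "Z 0 0 0 4"
  proof -
    show "Z 4 0 0 0" using assms(1) by (simp add: Z_def)
    then show "Z 0 4 0 0" by (rule Z_i)
    then show "Z 0 0 4 0" by (rule Z_w)
    then show "Z 0 0 0 4" by (rule Z_w)
  qed
  \<comment> \<open>w cycles x_1, x_2, x_3 and so links the monomials containing x_0; i leads from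
    x_0^2 x_2^2 to x_1^2 x_3^2, and w then reaches the other two.\<close>
  have Z_22: "Z 2 2 0 0" "Z 2 0 2 0" "Z 2 0 0 2" "Z 0 2 0 2" "Z 0 2 2 0" "Z 0 0 2 2"
  proof -
    show "Z 2 2 0 0" using assms(2) by (simp add: Z_def)
    then show "Z 2 0 2 0" by (rule Z_w)
    then show "Z 2 0 0 2" "Z 0 2 0 2" by (rule Z_w, rule Z_i)
    then show "Z 0 2 2 0" by (intro Z_w[of 0 2 0 2])
    then show "Z 0 0 2 2" by (rule Z_w)
  qed
  have Z: "Z a b c d" if deg: "a + b + c + d = 4" for a b c d
  \<comment> \<open>An odd b + c is moved by w to the last two places, where \<open>Z_parity\<close>
    applies. Otherwise b, c, d have equal parity, and the even degree gives a that parity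
    too.\<close>
  proof (cases "odd (c + d) \<or> odd (b + c)")
    case True
    then show ?thesis
    proof
      assume "odd (b + c)"
      then have "Z a d b c" by (rule Z_parity)
      then show ?thesis by (intro Z_w[of a c d b] Z_w[of a d b c])
    qed (rule Z_parity)
  next
    case False
    show ?thesis
    proof (cases "even d")
      case True
      with False deg have "even a" "even b" "even c" by presburger+
      with \<open>even d\<close> obtain a' b' c' d' where
        eq: "a = 2 * a'" "b = 2 * b'" "c = 2 * c'" "d = 2 * d'"
        by (elim evenE)
      then have "a' + b' + c' + d' = 2" using deg by simp
      \<comment> \<open>Halving the exponents leaves the ten ways of writing 2 as an ordered sum of
        four naturals.\<close>
      then have "(a', b', c', d') \<in> {(2,0,0,0), (0,2,0,0), (0,0,2,0), (0,0,0,2),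
          (1,1,0,0), (1,0,1,0), (1,0,0,1), (0,1,1,0), (0,1,0,1), (0,0,1,1)}"
        by simp presburger
      then show ?thesis unfolding eq using Z_4 Z_22 by auto
    next
      case False
      with \<open>\<not> (odd (c + d) \<or> odd (b + c))\<close> deg have "odd a" "odd b" "odd c"
        by presburger+
      \<comment> \<open>Four odd exponents with sum 4 are all 1.\<close>
      with False have "a \<ge> 1" "b \<ge> 1" "c \<ge> 1" "d \<ge> 1" by (auto simp: Suc_le_eq odd_pos)
      with deg have "a = 1" "b = 1" "c = 1" "d = 1" by linarith+
      then show ?thesis using Z_1111 by simp
    qed
  qed
  show "Poly_Mapping.lookup f m = Poly_Mapping.lookup 0 m"
  proof (cases "m \<in> Poly_Mapping.keys f")
    case True
    then have "(\<Sum>n\<in>UNIV. Poly_Mapping.lookup m n) = 4"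
      using f by (simp add: invariant_forms_def homogeneous_def)
    then show ?thesis
      using Z[of "Poly_Mapping.lookup m 0" "Poly_Mapping.lookup m 1" "Poly_Mapping.lookup m 2"
          "Poly_Mapping.lookup m 3"]
      by (simp add: Z_def exponent_lookup sum_4_from_0)
  qed (simp add: in_keys_iff)
qed

end

section \<open>Coefficients of the generators, and the dimension\<close>

lemma exponent_eq_iff:
  "exponent a b c d = exponent a' b' c' d' \<longleftrightarrow> a = a' \<and> b = b' \<and> c = c' \<and> d = d'"
  by (metis lookup_exponent)

lemma exponent_add: "exponent a b c d + exponent a' b' c' d' = exponent (a + a') (b + b') (c + c') (d + d')"
  by (simp add: exponent_def single_add ac_simps)

lemma X_power_exponent:
  "X 0 ^ k = Poly_Mapping.single (exponent k 0 0 0) 1"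
  "X 1 ^ k = Poly_Mapping.single (exponent 0 k 0 0) 1"
  "X 2 ^ k = Poly_Mapping.single (exponent 0 0 k 0) 1"
  "X 3 ^ k = Poly_Mapping.single (exponent 0 0 0 k) 1"
  by (simp_all add: X_power exponent_def)

lemma lookup_Const_mult: "Poly_Mapping.lookup (Const c * f) m = c * Poly_Mapping.lookup f m"
  unfolding Const_def mult_map_scale_conv_mult[symmetric] by (simp add: Poly_Mapping.map.rep_eq when_def)

theorem mainTheorem2:
  fixes q f\<^sub>0 :: poly4
  assumes "q = X 0 ^ 2 + X 1 ^ 2 + X 2 ^ 2 + X 3 ^ 2"
    and "f\<^sub>0 = X 0 ^ 4 + X 1 ^ 4 + X 2 ^ 4 + X 3 ^ 4"
  shows "poly4.dim (invariant_forms OO' 4) = 2 \<and> invariant_forms OO' 4 = poly4.span {q\<^sup>2, f\<^sub>0}"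
proof -
  have coeff_q: "Poly_Mapping.lookup (q\<^sup>2) (exponent 4 0 0 0) = 1"
    "Poly_Mapping.lookup (q\<^sup>2) (exponent 2 2 0 0) = 2"
    \<comment> \<open>The pattern \<open>_ + _\<close> expands only the outer square and leaves the
      powers \<open>X n ^ 2\<close> intact for \<open>X_power_exponent\<close>.\<close>
    by (simp_all add: assms(1) power2_eq_square[of "_ + _"] X_power_exponent distrib_left distrib_right
        mult_single exponent_add lookup_add lookup_single exponent_eq_iff)
  have coeff_f\<^sub>0: "Poly_Mapping.lookup f\<^sub>0 (exponent 4 0 0 0) = 1"
    "Poly_Mapping.lookup f\<^sub>0 (exponent 2 2 0 0) = 0"
    by (simp_all add: assms(2) X_power_exponent lookup_add lookup_single exponent_eq_iff)
  have inv: "q\<^sup>2 \<in> invariant_forms OO' 4" "f\<^sub>0 \<in> invariant_forms OO' 4"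
  proof -
    have "homogeneous 2 q" "homogeneous 4 f\<^sub>0"
      unfolding assms by (intro homogeneous_add homogeneous_X_power)+
    moreover from this(1) have "homogeneous 4 (q\<^sup>2)"
      using homogeneous_mult[of 2 q 2 q] by (simp add: power2_eq_square)
    moreover have "linear_subst A (q\<^sup>2) = q\<^sup>2 \<and> linear_subst A f\<^sub>0 = f\<^sub>0" if A: "A \<in> OO'" for A
    proof -
      obtain \<pi> s g where "A = matrix g" "signed_permutation \<pi> s g"
        using OO'_signed_permutation[OF A] .
      then have "linear_subst A q = q" "linear_subst A f\<^sub>0 = f\<^sub>0"
        unfolding assms by (simp_all only: linear_subst_power_sum even_numeral)
      \<comment> \<open>Substitution commutes with powers, so the invariance of \<open>q\<close>
        passes to its square.\<close>
      then show ?thesis by (simp add: linear_subst_def substitute_power)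
    qed
    ultimately show "q\<^sup>2 \<in> invariant_forms OO' 4" "f\<^sub>0 \<in> invariant_forms OO' 4"
      by (simp_all add: invariant_forms_def)
  qed
  note subspace = subspace_invariant_forms[of OO' 4]
  have span: "invariant_forms OO' 4 = poly4.span {q\<^sup>2, f\<^sub>0}"
  proof
    show "poly4.span {q\<^sup>2, f\<^sub>0} \<subseteq> invariant_forms OO' 4"
      using inv by (intro poly4.span_minimal subspace) simp
    show "invariant_forms OO' 4 \<subseteq> poly4.span {q\<^sup>2, f\<^sub>0}"
    proof
      fix f assume f: "f \<in> invariant_forms OO' 4"
      \<comment> \<open>The coefficients of \<beta> q^2 + \<alpha> f_0 at x_0^2 x_1^2 and x_0^4 are
        2 \<beta> and \<beta> + \<alpha>; matching them with those of \<open>f\<close> determines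
        both scalars.\<close>
      define \<beta> where "\<beta> = Poly_Mapping.lookup f (exponent 2 2 0 0) / 2"
      define \<alpha> where "\<alpha> = Poly_Mapping.lookup f (exponent 4 0 0 0) - \<beta>"
      let ?g = "Const \<beta> * q\<^sup>2 + Const \<alpha> * f\<^sub>0"
      have "f - ?g = 0"
      proof (rule invariant_quartic_eq_0)
        show "f - ?g \<in> invariant_forms OO' 4"
          by (intro poly4.subspace_diff poly4.subspace_add poly4.subspace_scale subspace f inv)
        show "Poly_Mapping.lookup (f - ?g) (exponent 4 0 0 0) = 0"
          "Poly_Mapping.lookup (f - ?g) (exponent 2 2 0 0) = 0"
          by (simp_all add: lookup_minus lookup_add lookup_Const_mult coeff_q coeff_f\<^sub>0 \<alpha>_def \<beta>_def)
      qed
      then have "f = ?g" by simp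
      moreover have "?g \<in> poly4.span {q\<^sup>2, f\<^sub>0}"
        by (intro poly4.span_add poly4.span_scale poly4.span_base) simp_all
      ultimately show "f \<in> poly4.span {q\<^sup>2, f\<^sub>0}" by simp
    qed
  qed
  have "q\<^sup>2 \<noteq> f\<^sub>0" using coeff_q(2) coeff_f\<^sub>0(2) by auto
  moreover have "poly4.independent {q\<^sup>2, f\<^sub>0}"
  proof -
    \<comment> \<open>The monomial x_0^2 x_1^2 occurs in q^2 but in no multiple of f_0.\<close>
    have "q\<^sup>2 \<notin> poly4.span {f\<^sub>0}"
    proof
      assume "q\<^sup>2 \<in> poly4.span {f\<^sub>0}"
      then obtain c where "q\<^sup>2 = Const c * f\<^sub>0" unfolding poly4.span_singleton by blast
      then show False using lookup_Const_mult[of c f\<^sub>0 "exponent 2 2 0 0"] coeff_q(2) coeff_f\<^sub>0(2)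
        by simp
    qed
    moreover have "f\<^sub>0 \<noteq> 0" using coeff_f\<^sub>0(1) by auto
    ultimately show ?thesis by (simp add: poly4.independent_insert)
  qed
  ultimately have "poly4.dim (invariant_forms OO' 4) = 2"
    unfolding span by (simp add: poly4.dim_eq_card_independent)
  with span show ?thesis by simp
qed

end
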